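(* Let $n, m, N$ be positive integers and let $t$ be a non-negative integer such that $3\leq n\leq t+4$, $m-2\not\equiv 0\pmod{n-1}$, and $(t+1)(n-1)(m-1)+1\leq N\leq (t+1)(n-1)(m-1)+m-1$. Let $G$ be a graph on $N$ vertices with minimum degree $$\delta(G)\geq N-\left\lceil \frac{t+1}{t+2}\left\lceil \frac{N}{m-1}\right\rceil\right\rceil.$$ Then $G\rightarrow (P_n, K_m)$.
   Context: All graphs are finite and simple. For graphs $G, G_1, G_2$, the notation $G\rightarrow (G_1, G_2)$ means that every coloring of the edges of $G$ with two colors, red and blue, yields a red copy of $G_1$ or a blue copy of $G_2$ (copies are as not necessarily induced subgraphs). $P_n$ is the path on $n$ vertices and $K_m$ is the complete graph on $m$ vertices. (When $m=1$ the range for $N$ is empty, so the statement is vacuous.) *)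

theory Defs
  imports Complex_Main "HOL-Library.Ramsey" "HOL-Number_Theory.Cong"
begin

type_synonym 'a graph = "'a set \<times> 'a set set"

abbreviation vertices :: "'a graph \<Rightarrow> 'a set" where
  "vertices G \<equiv> fst G"

abbreviation edges :: "'a graph \<Rightarrow> 'a set set" where
  "edges G \<equiv> snd G"

definition simple_graph :: "'a graph \<Rightarrow> bool" where
  "simple_graph G \<longleftrightarrow> finite (vertices G) \<and> edges G \<subseteq> [vertices G]\<^bsup>2\<^esup>"

definition vertex_degree :: "'a graph \<Rightarrow> 'a \<Rightarrow> nat" where
  "vertex_degree G v = card {e \<in> edges G. v \<in> e}"

(* Only meaningful for graphs with a nonempty finite vertex set. *)
definition min_degree :: "'a graph \<Rightarrow> nat" where
  "min_degree G = Min (vertex_degree G ` vertices G)"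

(* n is the number of vertices, not the number of edges. *)
definition path_graph :: "nat \<Rightarrow> nat graph" where
  "path_graph n = ({..<n}, {{i, Suc i} | i. Suc i < n})"

definition complete_graph :: "nat \<Rightarrow> nat graph" where
  "complete_graph m = ({..<m}, [{..<m}]\<^bsup>2\<^esup>)"

(* Copies need not be induced: non-edges of H are unconstrained. *)
definition contains_copy :: "'a graph \<Rightarrow> 'b graph \<Rightarrow> bool" where
  "contains_copy G H \<longleftrightarrow>
     (\<exists>f. inj_on f (vertices H) \<and> f ` vertices H \<subseteq> vertices G \<and>
          (\<forall>e \<in> edges H. f ` e \<in> edges G))"

datatype colour = Red | Blue

definition colour_subgraph :: "'a graph \<Rightarrow> ('a set \<Rightarrow> colour) \<Rightarrow> colour \<Rightarrow> 'a graph" where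
  "colour_subgraph G c k = (vertices G, {e \<in> edges G. c e = k})"

(* A colouring is a total function on sets; its values outside the edge set are irrelevant. *)
definition arrows :: "'a graph \<Rightarrow> 'b graph \<Rightarrow> 'c graph \<Rightarrow> bool" where
  "arrows G G\<^sub>1 G\<^sub>2 \<longleftrightarrow>
     (\<forall>c. contains_copy (colour_subgraph G c Red) G\<^sub>1 \<or>
          contains_copy (colour_subgraph G c Blue) G\<^sub>2)"

end

theory Submission
  imports Defs
begin

text \<open>
  Let \<open>D = (t + 1) (n - 1)\<close>. The degree condition says that the complement \<open>H\<close> of \<open>G\<close> has maximum
  degree at most \<open>t (n - 1) + 1 = D - (n - 2)\<close>. If the red graph \<open>R\<close> has no \<open>P\<^sub>n\<close>, an
  independent set of size \<open>m\<close> in \<open>R \<union> H\<close> is found by induction on \<open>m\<close>, starting from exactly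
  \<open>D (m - 1) + 1\<close> vertices. A vertex of degree less than \<open>D\<close> in \<open>R \<union> H\<close> is put into the
  independent set and deleted with its neighbours. If there is none, \<open>R\<close> has minimum degree at
  least \<open>n - 2\<close> and no \<open>P\<^sub>n\<close>, hence is a disjoint union of copies of \<open>K\<^bsub>n-1\<^esub>\<close>; then \<open>n - 1\<close>
  divides both \<open>D\<close> and \<open>D (m - 1) + 1\<close>, which is impossible.
\<close>

section \<open>Longest paths and the sets of vertices they split off\<close>

definition path_in :: "('a \<Rightarrow> 'a \<Rightarrow> bool) \<Rightarrow> 'a set \<Rightarrow> 'a list \<Rightarrow> bool" where
  "path_in R V xs \<longleftrightarrow> distinct xs \<and> set xs \<subseteq> V \<and> successively R xs"

lemma path_in_mono: "path_in R V xs \<Longrightarrow> V \<subseteq> W \<Longrightarrow> path_in R W xs"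
  by (auto simp: path_in_def)

text \<open>The closing edge supplies the one new adjacency. It is asked for only from two vertices
  on, since for a single vertex it would be a loop.\<close>

lemma path_in_rotate:
  assumes "path_in R V xs" and "xs \<noteq> []" and "length xs \<ge> 2 \<Longrightarrow> R (last xs) (hd xs)"
  shows "path_in R V (rotate1 xs)"
proof (cases xs)
  case (Cons x ys)
  with assms show ?thesis
    using successively_append_iff[of R ys "[x]"]
    by (cases "ys = []") (auto simp: path_in_def successively_Cons Suc_le_eq)
qed (use assms in simp)

text \<open>
  A longest path has exactly \<open>k + 1\<close> vertices and closes up to a cycle, so no edge leaves its
  vertex set: such an edge would extend a rotation of the path.
\<close>
lemma closed_path_exists:
  assumes "finite V" and "V \<noteq> {}" and sym: "symp R" and irr: "irreflp R"
    and deg: "\<And>v. v \<in> V \<Longrightarrow> k \<le> card {u \<in> V. R v u}"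
    and nopath: "\<And>xs. path_in R V xs \<Longrightarrow> length xs \<noteq> k + 2"
  obtains X where "X \<subseteq> V" and "card X = k + 1"
    and "\<And>x y. x \<in> X \<Longrightarrow> y \<in> V - X \<Longrightarrow> \<not> R x y"
proof -
  \<comment> \<open>\<open>nopath\<close> excludes a single length; any longer path has a prefix of
    exactly that length.\<close>
  have short: "length xs \<le> k + 1" if "path_in R V xs" for xs
  proof (rule ccontr)
    assume "\<not> ?thesis"
    moreover have "successively R (take (k + 2) xs)"
      using that successively_append_iff[of R "take (k + 2) xs" "drop (k + 2) xs"]
      by (simp add: path_in_def)
    ultimately show False
      using nopath[of "take (k + 2) xs"] that
      by (auto simp: path_in_def dest: in_set_takeD)
  qed
  obtain v where "v \<in> V" using \<open>V \<noteq> {}\<close> by blast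
  then have v: "path_in R V [v]" by (simp add: path_in_def)
  obtain xs where xs: "path_in R V xs"
    and longest: "\<And>ys. path_in R V ys \<Longrightarrow> length ys \<le> length xs"
    using ex_has_greatest_nat[of "path_in R V" "[v]" length "k + 2"] v short
    by (force simp: less_Suc_eq_le)
  have ne: "xs \<noteq> []" using longest[OF v] by auto
  \<comment> \<open>A neighbour of the head outside the path could be prepended, against
    maximality.\<close>
  have nbrs: "{u \<in> V. R (hd xs) u} \<subseteq> set xs - {hd xs}"
  proof
    fix u assume u: "u \<in> {u \<in> V. R (hd xs) u}"
    then have "R u (hd xs)" "u \<noteq> hd xs"
      using sym irr by (auto dest: sympD irreflpD)
    moreover have "u \<in> set xs"
    proof (rule ccontr)
      assume "u \<notin> set xs"
      with \<open>R u (hd xs)\<close> u xs have "path_in R V (u # xs)"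
        by (auto simp: path_in_def successively_Cons)
      then show False using longest by fastforce
    qed
    ultimately show "u \<in> set xs - {hd xs}" by simp
  qed
  have card_xs: "card (set xs) = length xs"
    using xs by (simp add: path_in_def distinct_card)
  have "hd xs \<in> V" using xs ne by (auto simp: path_in_def)
  then have "k \<le> card {u \<in> V. R (hd xs) u}" by (rule deg)
  moreover have "card (set xs - {hd xs}) = length xs - 1"
    using ne card_xs by simp
  moreover have "length xs \<ge> 1" using ne by (cases xs) auto
  \<comment> \<open>The head has at least \<open>k\<close> neighbours, all among the other
    \<open>length xs - 1\<close> vertices, and \<open>short\<close> bounds that number by
    \<open>k\<close>. So equality holds throughout, and the head is adjacent to every other vertex
    of the path, the last one included.\<close>
  ultimately have len: "length xs = k + 1"
    and all: "{u \<in> V. R (hd xs) u} = set xs - {hd xs}"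
  proof -
    assume *: "k \<le> card {u \<in> V. R (hd xs) u}" "card (set xs - {hd xs}) = length xs - 1"
      "length xs \<ge> 1"
    have "card {u \<in> V. R (hd xs) u} \<le> length xs - 1"
      using card_mono[OF _ nbrs] * by simp
    then show "length xs = k + 1" using * short[OF xs] by linarith
    then show "{u \<in> V. R (hd xs) u} = set xs - {hd xs}"
      using * by (intro card_subset_eq nbrs) (use card_mono[OF _ nbrs] in auto)
  qed
  have closing: "R (last xs) (hd xs)" if "length xs \<ge> 2"
  proof -
    have "last xs \<noteq> hd xs"
      using xs that by (cases xs) (auto simp: path_in_def)
    then have "R (hd xs) (last xs)" using all last_in_set[OF ne] by blast
    then show ?thesis by (rule sympD[OF sym])
  qed
  \<comment> \<open>The closing edge belongs to the induction claim because each rotation opens the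
    cycle at a new place.\<close>
  have cyc: "path_in R V (rotate i xs) \<and>
      (length xs \<ge> 2 \<longrightarrow> R (last (rotate i xs)) (hd (rotate i xs)))" for i
  proof (induction i)
    case 0
    show ?case using xs closing by simp
  next
    case (Suc i)
    obtain y ys where y: "rotate i xs = y # ys"
      using ne by (metis list.exhaust rotate_is_Nil_conv)
    have "length xs = length (y # ys)" using y by (metis length_rotate)
    then show ?case using Suc y path_in_rotate[of R V "y # ys"]
      by (cases "ys = []") (auto simp: path_in_def successively_Cons)
  qed
  show thesis
  proof
    show "set xs \<subseteq> V" using xs by (simp add: path_in_def)
    show "card (set xs) = k + 1" using card_xs len by simp
    fix x y assume x: "x \<in> set xs" and y: "y \<in> V - set xs"
    show "\<not> R x y"
    proof
      assume "R x y"
      then have "R y x" using sym by (auto dest: sympD)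
      obtain i where i: "i < length xs" "xs ! i = x"
        using x by (auto simp: in_set_conv_nth)
      then have "hd (rotate i xs) = x"
        using ne by (simp add: hd_rotate_conv_nth)
      with cyc[of i] y \<open>R y x\<close> have "path_in R V (y # rotate i xs)"
        by (auto simp: path_in_def successively_Cons)
      then show False using longest by fastforce
    qed
  qed
qed

text \<open>Blocks of \<open>k + 1\<close> vertices are peeled off one at a time. No edge joins a
  block to the rest, so the remaining vertices keep their degrees and the hypotheses
  persist.\<close>

lemma no_path_min_degree_dvd_card:
  assumes "finite V" and "symp R" and "irreflp R"
    and "\<And>v. v \<in> V \<Longrightarrow> k \<le> card {u \<in> V. R v u}"
    and "\<And>xs. path_in R V xs \<Longrightarrow> length xs \<noteq> k + 2"
  shows "k + 1 dvd card V"
  using assms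
proof (induction "card V" arbitrary: V rule: less_induct)
  case less
  show ?case
  proof (cases "V = {}")
    case False
    obtain X where X: "X \<subseteq> V" "card X = k + 1"
      and out: "\<And>x y. x \<in> X \<Longrightarrow> y \<in> V - X \<Longrightarrow> \<not> R x y"
      using closed_path_exists[OF less.prems(1) False less.prems(2-5)] by metis
    have card_diff: "card V = card (V - X) + (k + 1)"
      using X less.prems(1) by (metis card_Diff_subset card_mono finite_subset le_add_diff_inverse2)
    have "k + 1 dvd card (V - X)"
    proof (rule less.hyps)
      show "card (V - X) < card V" using card_diff by simp
      show "k \<le> card {u \<in> V - X. R v u}" if "v \<in> V - X" for v
      proof -
        have "{u \<in> V. R v u} = {u \<in> V - X. R v u}"
          using out that less.prems(2) by (blast dest: sympD)
        then show ?thesis using less.prems(4) that by (metis DiffD1)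
      qed
      show "length xs \<noteq> k + 2" if "path_in R (V - X) xs" for xs
        using path_in_mono[OF that] less.prems(5) by blast
    qed (use less.prems in auto)
    then show ?thesis unfolding card_diff by (rule dvd_add) simp
  qed simp
qed

section \<open>Greedy choice of an independent set\<close>

lemma independent_set_exists:
  assumes "finite V" and "symp R" and "irreflp R" and "symp H"
    and "\<And>v. v \<in> V \<Longrightarrow> card {u \<in> V. H v u} \<le> h"
    and "\<And>xs. path_in R V xs \<Longrightarrow> length xs \<noteq> k + 2"
    and "k + h \<le> D" and "k + 1 dvd D" and "k \<ge> 1"
    and "D * m + 1 \<le> card V"
  shows "\<exists>I \<subseteq> V. card I = m + 1 \<and> pairwise (\<lambda>u v. \<not> R u v \<and> \<not> H u v) I"
  using assms(1,5,6,10)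
proof (induction m arbitrary: V)
  case 0
  then obtain v where "v \<in> V" by fastforce
  then show ?case by (intro exI[of _ "{v}"]) auto
next
  case (Suc m)
  \<comment> \<open>Trimming to exactly \<open>D * Suc m + 1\<close> vertices fixes the residue: it
    is 1 modulo \<open>k + 1\<close>, while the cardinality of \<open>V\<close> itself might be
    divisible by \<open>k + 1\<close>.\<close>
  obtain W where W: "W \<subseteq> V" "card W = D * Suc m + 1" "finite W"
    using obtain_subset_with_card_n[OF Suc.prems(4)] by metis
  have degH: "card {u \<in> U. H v u} \<le> h" if "U \<subseteq> V" "v \<in> U" for U v
  proof -
    have "card {u \<in> U. H v u} \<le> card {u \<in> V. H v u}"
      using that Suc.prems(1) by (intro card_mono) auto
    then show ?thesis using Suc.prems(2)[of v] that by auto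
  qed
  have nopath: "length xs \<noteq> k + 2" if "U \<subseteq> V" "path_in R U xs" for U xs
    using path_in_mono[OF that(2,1)] Suc.prems(3) by blast
  define nbhd where "nbhd v = {u \<in> W. R v u \<or> H v u}" for v
  have "\<exists>v \<in> W. card (nbhd v) < D"
  proof (rule ccontr)
    assume "\<not> ?thesis"
    then have large: "D \<le> card (nbhd v)" if "v \<in> W" for v
      using that by force
    have "k \<le> card {u \<in> W. R v u}" if "v \<in> W" for v
    proof -
      have "nbhd v = {u \<in> W. R v u} \<union> {u \<in> W. H v u}"
        by (auto simp: nbhd_def)
      then have "card (nbhd v) \<le> card {u \<in> W. R v u} + card {u \<in> W. H v u}"
        by (simp add: card_Un_le)
      then show ?thesis
        using large[OF that] degH[OF W(1) that] \<open>k + h \<le> D\<close> by linarith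
    qed
    then have "k + 1 dvd D * Suc m + 1"
      using no_path_min_degree_dvd_card[of W R k] W nopath[OF W(1)] assms(2,3) by metis
    then have "k + 1 dvd 1"
      using \<open>k + 1 dvd D\<close> by (metis dvd_add_right_iff dvd_mult2)
    then show False using \<open>k \<ge> 1\<close> by simp
  qed
  then obtain v where v: "v \<in> W" "card (nbhd v) < D" by blast
  define U where "U = W - insert v (nbhd v)"
  \<comment> \<open>The vertex \<open>v\<close> is deleted along with its neighbours; the strict
    bound on \<open>nbhd v\<close> makes room for it, so at most \<open>D\<close> vertices are
    lost.\<close>
  have "card (insert v (nbhd v)) \<le> D"
    using v(2) card_insert_le_m1[of D "nbhd v" v] by (simp add: card_insert_if nbhd_def W(3))
  moreover have "card W - card (insert v (nbhd v)) \<le> card U"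
    unfolding U_def by (rule diff_card_le_card_Diff) (simp add: nbhd_def W(3))
  ultimately have "D * m + 1 \<le> card U" using W(2) by simp
  moreover have "U \<subseteq> V" "finite U" using W by (auto simp: U_def)
  ultimately have "\<exists>I \<subseteq> U. card I = m + 1 \<and> pairwise (\<lambda>u v. \<not> R u v \<and> \<not> H u v) I"
    by (intro Suc.IH degH nopath)
  then obtain I where I: "I \<subseteq> U" "card I = m + 1"
      "pairwise (\<lambda>u v. \<not> R u v \<and> \<not> H u v) I"
    by blast
  show ?case
  proof (intro exI[of _ "insert v I"] conjI)
    show "insert v I \<subseteq> V" using v I \<open>U \<subseteq> V\<close> W by auto
    have "v \<notin> I" "finite I" using I \<open>finite U\<close> by (auto simp: U_def intro: finite_subset)
    then show "card (insert v I) = Suc m + 1" using I(2) by simp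
    have "\<not> R v u" "\<not> H v u" "\<not> R u v" "\<not> H u v" if "u \<in> I" for u
      using that I(1) assms(2,4) by (auto simp: U_def nbhd_def dest: sympD)
    then show "pairwise (\<lambda>u v. \<not> R u v \<and> \<not> H u v) (insert v I)"
      using I(3) by (auto simp: pairwise_insert)
  qed
qed

section \<open>From edge sets and colourings to relations\<close>

lemma vertex_degree_eq_card_neighbours:
  assumes "simple_graph G"
  shows "vertex_degree G v = card {u \<in> vertices G. {v, u} \<in> edges G}"
proof -
  have E: "e \<subseteq> vertices G \<and> card e = 2" if "e \<in> edges G" for e
    using assms that by (auto simp: simple_graph_def nsets_def)
  have "bij_betw (\<lambda>u. {v, u}) {u \<in> vertices G. {v, u} \<in> edges G} {e \<in> edges G. v \<in> e}"
  proof (rule bij_betw_imageI)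
    show "inj_on (\<lambda>u. {v, u}) {u \<in> vertices G. {v, u} \<in> edges G}"
      by (auto simp: inj_on_def doubleton_eq_iff)
    have "\<exists>u \<in> vertices G. e = {v, u}" if "e \<in> edges G" "v \<in> e" for e
      using E[OF that(1)] that(2) by (auto simp: card_2_iff)
    then show "(\<lambda>u. {v, u}) ` {u \<in> vertices G. {v, u} \<in> edges G} = {e \<in> edges G. v \<in> e}"
      by auto
  qed
  then show ?thesis by (simp add: vertex_degree_def bij_betw_same_card)
qed

text \<open>This turns a lower bound on degrees in \<open>G\<close> into an upper bound on degrees
  in its complement; the summand 1 counts \<open>v\<close>.\<close>

lemma card_non_neighbours:
  assumes "simple_graph G" and "v \<in> vertices G"
  shows "card {u \<in> vertices G. v \<noteq> u \<and> {v, u} \<notin> edges G} + vertex_degree G v + 1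
    = card (vertices G)"
proof -
  let ?A = "{u \<in> vertices G. v \<noteq> u \<and> {v, u} \<notin> edges G}"
  let ?B = "{u \<in> vertices G. {v, u} \<in> edges G}"
  have fin: "finite (vertices G)" using assms by (simp add: simple_graph_def)
  have v: "v \<notin> ?B"
    using assms(1) by (auto simp: simple_graph_def nsets_def)
  have "vertices G = insert v (?A \<union> ?B)" using assms(2) by auto
  also have "card \<dots> = Suc (card (?A \<union> ?B))"
    using fin v by (intro card_insert_disjoint) auto
  also have "card (?A \<union> ?B) = card ?A + card ?B"
    using fin by (intro card_Un_disjoint) auto
  finally show ?thesis
    using vertex_degree_eq_card_neighbours[OF assms(1)] by simp
qed

lemma contains_path_graphI:
  assumes "path_in (\<lambda>u v. {u, v} \<in> edges G) (vertices G) xs" and "length xs = n"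
  shows "contains_copy G (path_graph n)"
  unfolding contains_copy_def
proof (intro exI[of _ "\<lambda>i. xs ! i"] conjI)
  show "inj_on ((!) xs) (vertices (path_graph n))"
    using assms by (simp add: path_graph_def path_in_def inj_on_nth)
  show "(!) xs ` vertices (path_graph n) \<subseteq> vertices G"
    using assms by (auto simp: path_graph_def path_in_def)
  show "\<forall>e \<in> edges (path_graph n). (!) xs ` e \<in> edges G"
    using assms by (auto simp: path_graph_def path_in_def successively_conv_nth)
qed

lemma contains_complete_graphI:
  assumes "I \<subseteq> vertices G" and "finite I" and "card I = m"
    and "pairwise (\<lambda>u v. {u, v} \<in> edges G) I"
  shows "contains_copy G (complete_graph m)"
proof -
  obtain f where f: "bij_betw f {..<m} I"
    using assms(2,3) by (metis bij_betw_from_nat_into_finite)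
  have "f ` e \<in> edges G" if e: "e \<in> [{..<m}]\<^bsup>2\<^esup>" for e
  proof -
    obtain i j where "e = {i, j}" "i < m" "j < m" "i \<noteq> j"
      using e by (auto simp: nsets_def card_2_iff)
    then have "f i \<in> I" "f j \<in> I" "f i \<noteq> f j"
      using f by (auto simp: bij_betw_def inj_on_def)
    then show ?thesis using assms(4) \<open>e = {i, j}\<close> by (auto simp: pairwise_def)
  qed
  then show ?thesis
    using f assms(1) unfolding contains_copy_def
    by (intro exI[of _ f]) (auto simp: complete_graph_def bij_betw_def)
qed

text \<open>Two vertices that are adjacent neither in red nor in the complement of \<open>G\<close>
  are joined by a blue edge, so the independent set found for these two relations is a blue
  clique.\<close>

lemma arrows_path_complete:
  assumes G: "simple_graph G"
    and card: "(t + 1) * (k + 1) * m + 1 \<le> card (vertices G)"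
    and deg: "\<And>v. v \<in> vertices G \<Longrightarrow> card (vertices G) \<le> vertex_degree G v + t * (k + 1) + 2"
    and "k \<ge> 1"
  shows "arrows G (path_graph (k + 2)) (complete_graph (m + 1))"
  unfolding arrows_def
proof (intro allI disjCI)
  fix c
  assume noblue: "\<not> contains_copy (colour_subgraph G c Blue) (complete_graph (m + 1))"
  define R where "R u v \<longleftrightarrow> {u, v} \<in> edges (colour_subgraph G c Red)" for u v
  define H where "H u v \<longleftrightarrow> u \<noteq> v \<and> {u, v} \<notin> edges G" for u v
  have fin: "finite (vertices G)" using G by (simp add: simple_graph_def)
  show "contains_copy (colour_subgraph G c Red) (path_graph (k + 2))"
  proof (rule ccontr)
    assume nored: "\<not> ?thesis"
    have "\<exists>I \<subseteq> vertices G. card I = m + 1 \<and> pairwise (\<lambda>u v. \<not> R u v \<and> \<not> H u v) I"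
    proof (rule independent_set_exists)
      show "symp R" "symp H" by (auto simp: R_def H_def insert_commute intro!: sympI)
      show "irreflp R"
        using G by (auto simp: R_def colour_subgraph_def simple_graph_def nsets_def irreflp_def)
      show "card {u \<in> vertices G. H v u} \<le> t * (k + 1) + 1" if "v \<in> vertices G" for v
        using card_non_neighbours[OF G that] deg[OF that] by (simp add: H_def)
      show "length xs \<noteq> k + 2" if "path_in R (vertices G) xs" for xs
        using nored that contains_path_graphI[of "colour_subgraph G c Red" xs]
        unfolding R_def[abs_def] by (auto simp: colour_subgraph_def)
      \<comment> \<open>Both sides are equal: the degree condition gives exactly the complement
        degree that the greedy argument tolerates.\<close>
      show "k + (t * (k + 1) + 1) \<le> (t + 1) * (k + 1)" by simp
      show "k + 1 dvd (t + 1) * (k + 1)" by (rule dvd_triv_right)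
    qed (use fin card \<open>k \<ge> 1\<close> in auto)
    then obtain I where I: "I \<subseteq> vertices G" "card I = m + 1"
        "pairwise (\<lambda>u v. \<not> R u v \<and> \<not> H u v) I"
      by blast
    have "pairwise (\<lambda>u v. {u, v} \<in> edges (colour_subgraph G c Blue)) I"
      using I(3) colour.exhaust
      by (auto simp: pairwise_def R_def H_def colour_subgraph_def)
    moreover have "finite I" using I(1) fin by (rule finite_subset)
    ultimately show False
      using noblue I contains_complete_graphI[of I "colour_subgraph G c Blue"]
      by (auto simp: colour_subgraph_def)
  qed
qed

section \<open>Arithmetic of the degree condition\<close>

text \<open>The range of \<open>N\<close> places \<open>N / p\<close> above \<open>?D\<close> and at
  most at \<open>?D + 1\<close>, so the inner ceiling is \<open>?D + 1\<close>. Multiplying by the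
  fraction gives the integer \<open>t * (k + 1) + 1\<close> plus \<open>k / (t + 2)\<close>, and
  \<open>1 \<le> k \<le> t + 2\<close> puts this remainder in the interval (0, 1]. This is where the
  bound \<open>n \<le> t + 4\<close> enters.\<close>

lemma ceiling_degree_bound:
  fixes k t p N :: nat
  assumes "k \<ge> 1" and "k \<le> t + 2" and "p > 0"
    and lower: "(t + 1) * (k + 1) * p + 1 \<le> N" and upper: "N \<le> (t + 1) * (k + 1) * p + p"
  shows "\<lceil>(real t + 1) / (real t + 2) * of_int \<lceil>real N / real p\<rceil>\<rceil> = int (t * (k + 1) + 2)"
proof -
  let ?D = "(t + 1) * (k + 1)"
  have "\<lceil>real N / real p\<rceil> = int (?D + 1)"
  proof (rule ceiling_unique)
    have "real ?D * real p < real N"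
      using lower by (metis Suc_eq_plus1 Suc_le_lessD of_nat_less_iff of_nat_mult)
    then show "of_int (int (?D + 1)) - 1 < real N / real p"
      using \<open>p > 0\<close> by (simp add: pos_less_divide_eq)
    have "N \<le> (?D + 1) * p" using upper by (simp add: algebra_simps)
    then have "real N \<le> real (?D + 1) * real p"
      by (metis of_nat_le_iff of_nat_mult)
    then show "real N / real p \<le> of_int (int (?D + 1))"
      using \<open>p > 0\<close> by (simp add: pos_divide_le_eq)
  qed
  then have "(real t + 1) / (real t + 2) * of_int \<lceil>real N / real p\<rceil>
      = real t * (real k + 1) + 1 + real k / (real t + 2)"
    by (simp add: divide_simps) (simp add: algebra_simps)
  moreover have "0 < real k / (real t + 2)" "real k / (real t + 2) \<le> 1"
    using assms(1,2) by (auto simp: divide_simps)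
  ultimately show ?thesis
    by (intro ceiling_unique) (auto simp: algebra_simps)
qed

theorem mainTheorem3:
  fixes n m N t :: nat and G :: "'a graph"
  assumes "n > 0" and "m > 0" and "N > 0"
    and "3 \<le> n" and "n \<le> t + 4"
    and "\<not> [int m - 2 = 0] (mod (int n - 1))"
    and "(t + 1) * (n - 1) * (m - 1) + 1 \<le> N"
    and "N \<le> (t + 1) * (n - 1) * (m - 1) + m - 1"
    and "simple_graph G" and "card (vertices G) = N"
    and "int (min_degree G) \<ge>
           int N - \<lceil>(real t + 1) / (real t + 2) * of_int \<lceil>real N / (real m - 1)\<rceil>\<rceil>"
  shows "arrows G (path_graph n) (complete_graph m)"
proof -
  obtain k where k: "n = k + 2" "k \<ge> 1" "k \<le> t + 2"
    using assms(4,5) by (intro that[of "n - 2"]) auto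
  obtain p where p: "m = p + 1" using \<open>m > 0\<close> by (metis Suc_eq_plus1 gr0_implies_Suc)
  have lower: "(t + 1) * (k + 1) * p + 1 \<le> N" and upper: "N \<le> (t + 1) * (k + 1) * p + p"
    using assms(7,8) k p by auto
  \<comment> \<open>For \<open>p = 0\<close> the two bounds would read \<open>1 \<le> N\<close> and
    \<open>N \<le> 0\<close>.\<close>
  then have "p > 0" by (cases p) auto
  have "int N - int (t * (k + 1) + 2) \<le> int (min_degree G)"
    using assms(11) ceiling_degree_bound[OF k(2,3) \<open>p > 0\<close> lower upper] p by simp
  then have "N \<le> min_degree G + t * (k + 1) + 2" by linarith
  moreover have "min_degree G \<le> vertex_degree G v" if "v \<in> vertices G" for v
    using that assms(9) by (simp add: min_degree_def simple_graph_def)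
  ultimately have "N \<le> vertex_degree G v + t * (k + 1) + 2" if "v \<in> vertices G" for v
    using that by (meson add_le_mono1 le_trans)
  then show ?thesis
    using arrows_path_complete[of G t k p] assms(9,10) lower k p by simp
qed

end
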